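(* Let $L$ be a frame and let $S=\ker(\mathbb{C}L\twoheadrightarrow\mathrm{Sk}\,\Sigma L)$, a congruence on the frame $\mathbb{C}L$. The following equivalences hold. (1) $S\le\mathfrak{D}$ if and only if $L$ is spatial. (2) $S$ is clear if and only if the space $\Sigma L$ is $T_D$. (3) $S=\mathfrak{D}$ if and only if $L$ is (isomorphic to) the frame of opens of a sober $T_D$ space. Here $\mathfrak{D}$ is the largest dense congruence on the frame $\mathbb{C}L$.
   Context: $\mathbb{C}L$ is the frame of all frame congruences on $L$ (equivalence relations closed under finite meets and arbitrary joins in $L\times L$), ordered by inclusion; for $a\in L$, $\nabla_a=\langle(0,a)\rangle$ is the congruence generated by $(0,a)$. $\Sigma L$ is the spectrum of $L$: the set of prime elements $p$ of $L$ ($p\neq1$ and $a\wedge b\le p$ implies $a\le p$ or $b\le p$) with open sets $U_a=\{p\mid a\not\le p\}$, $a\in L$. $L$ is spatial if $a\mapsto U_a$ is injective. For a space $(X,\tau)$, the total part of the Skula biframe $\mathrm{Sk}\,X$ is the frame of open sets of the Skula topology, i.e. the topology generated by the sets in $\tau$ and their complements (the first part being $\tau$ and the second part the topology generated by the complements of sets in $\tau$). The map $\mathbb{C}L\twoheadrightarrow\mathrm{Sk}\,\Sigma L$ is the unique frame homomorphism to the total part of $\mathrm{Sk}\,\Sigma L$ sending $\nabla_a$ to $U_a$ for all $a\in L$ (it is surjective); its kernel is $\{(A,B)\mid A\text{ and }B\text{ have the same image}\}$. For any frame $N$, the largest dense congruence on $N$ is $\{(x,y)\mid \forall z\in N:\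 x\wedge z=0\iff y\wedge z=0\}$ (a congruence $C$ is dense if $(0,x)\in C$ implies $x=0$). A congruence on $N$ is clear if it is of the form $\partial_c=\{(x,y)\mid \forall z\in N:\ x\wedge z\le c\iff y\wedge z\le c\}$ for some $c\in N$. A space $X$ is $T_D$ if for every $x\in X$ there is an open $U\ni x$ with $U\setminus\{x\}$ open. *)

theory Defs
  imports "HOL-Analysis.Abstract_Topology"
begin

unbundle lattice_syntax

text \<open>The class \<open>complete_distrib_lattice\<close> of the library asks for complete distributivity,
  which is stronger than the frame law.\<close>

class frame = complete_lattice +
  assumes inf_Sup_frame: "a \<sqinter> \<Squnion>B = (\<Squnion>b\<in>B. a \<sqinter> b)"

subclass (in frame) distrib_lattice
proof
  have d: "x \<sqinter> (y \<squnion> z) = (x \<sqinter> y) \<squnion> (x \<sqinter> z)" for x y z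
    using inf_Sup_frame[of x "{y, z}"] by simp
  show "x \<squnion> (y \<sqinter> z) = (x \<squnion> y) \<sqinter> (x \<squnion> z)" for x y z
    by (rule distrib_imp1) (rule d)
qed

text \<open>A family of related pairs is a set \<open>P \<subseteq> R\<close>; its join in \<open>L \<times> L\<close> is taken componentwise.
  The empty meet and the empty join are covered by reflexivity.\<close>

definition frame_congruence :: "('a::frame \<times> 'a) set \<Rightarrow> bool" where
  "frame_congruence R \<longleftrightarrow>
     equiv UNIV R \<and>
     (\<forall>a b c d. (a, b) \<in> R \<longrightarrow> (c, d) \<in> R \<longrightarrow> (a \<sqinter> c, b \<sqinter> d) \<in> R) \<and>
     (\<forall>P. P \<subseteq> R \<longrightarrow> (\<Squnion>(fst ` P), \<Squnion>(snd ` P)) \<in> R)"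

lemma frame_congruence_refl: "frame_congruence R \<Longrightarrow> (a, a) \<in> R"
  by (auto simp: frame_congruence_def equiv_def refl_on_def)

lemma frame_congruence_sym: "frame_congruence R \<Longrightarrow> (a, b) \<in> R \<Longrightarrow> (b, a) \<in> R"
  by (auto simp: frame_congruence_def equiv_def sym_def)

lemma frame_congruence_trans:
  "frame_congruence R \<Longrightarrow> (a, b) \<in> R \<Longrightarrow> (b, c) \<in> R \<Longrightarrow> (a, c) \<in> R"
  unfolding frame_congruence_def equiv_def by (meson transE)

lemma frame_congruence_inf:
  "frame_congruence R \<Longrightarrow> (a, b) \<in> R \<Longrightarrow> (c, d) \<in> R \<Longrightarrow> (a \<sqinter> c, b \<sqinter> d) \<in> R"
  by (auto simp: frame_congruence_def)

lemma frame_congruence_Sup: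
  "frame_congruence R \<Longrightarrow> P \<subseteq> R \<Longrightarrow> (\<Squnion>(fst ` P), \<Squnion>(snd ` P)) \<in> R"
  by (auto simp: frame_congruence_def)

lemma frame_congruence_sup:
  assumes "frame_congruence R" "(a, b) \<in> R" "(c, d) \<in> R"
  shows "(a \<squnion> c, b \<squnion> d) \<in> R"
  using frame_congruence_Sup[of R "{(a, b), (c, d)}"] assms by simp

lemma frame_congruenceI:
  assumes "\<And>a. (a, a) \<in> R"
    and "\<And>a b. (a, b) \<in> R \<Longrightarrow> (b, a) \<in> R"
    and "\<And>a b c. (a, b) \<in> R \<Longrightarrow> (b, c) \<in> R \<Longrightarrow> (a, c) \<in> R"
    and "\<And>a b c d. (a, b) \<in> R \<Longrightarrow> (c, d) \<in> R \<Longrightarrow> (a \<sqinter> c, b \<sqinter> d) \<in> R"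
    and "\<And>P. P \<subseteq> R \<Longrightarrow> (\<Squnion>(fst ` P), \<Squnion>(snd ` P)) \<in> R"
  shows "frame_congruence R"
  unfolding frame_congruence_def
  by (intro conjI equivI refl_onI symI transI allI impI) (auto intro: assms)

lemma frame_congruence_Inter:
  "(\<And>R. R \<in> \<R> \<Longrightarrow> frame_congruence R) \<Longrightarrow> frame_congruence (\<Inter>\<R>)"
  by (rule frame_congruenceI)
     (blast intro: frame_congruence_refl frame_congruence_sym frame_congruence_trans
        frame_congruence_inf frame_congruence_Sup)+

lemma frame_congruence_UNIV: "frame_congruence UNIV"
  by (rule frame_congruenceI) auto

typedef (overloaded) 'a congruence = "{R :: ('a::frame \<times> 'a) set. frame_congruence R}"
  morphisms rel_of Congruence
  by (rule exI[of _ UNIV]) (simp add: frame_congruence_UNIV)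

setup_lifting type_definition_congruence

lemma frame_congruence_rel_of: "frame_congruence (rel_of C)"
  using rel_of by auto

lift_definition generated_congruence :: "('a::frame \<times> 'a) set \<Rightarrow> 'a congruence" is
  "\<lambda>P. \<Inter>{R. frame_congruence R \<and> P \<subseteq> R}"
  by (rule frame_congruence_Inter) auto

instantiation congruence :: (frame) complete_lattice
begin

lift_definition less_eq_congruence :: "'a congruence \<Rightarrow> 'a congruence \<Rightarrow> bool" is "(\<subseteq>)" .

definition less_congruence :: "'a congruence \<Rightarrow> 'a congruence \<Rightarrow> bool" where
  "less_congruence C D \<longleftrightarrow> C \<le> D \<and> \<not> D \<le> C"

lift_definition Inf_congruence :: "'a congruence set \<Rightarrow> 'a congruence" is "\<lambda>\<R>. \<Inter>\<R>"
  by (rule frame_congruence_Inter) auto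

definition Sup_congruence :: "'a congruence set \<Rightarrow> 'a congruence" where
  "Sup_congruence \<C> = generated_congruence (\<Union>(rel_of ` \<C>))"

definition inf_congruence :: "'a congruence \<Rightarrow> 'a congruence \<Rightarrow> 'a congruence" where
  "inf_congruence C D = \<Sqinter>{C, D}"

definition sup_congruence :: "'a congruence \<Rightarrow> 'a congruence \<Rightarrow> 'a congruence" where
  "sup_congruence C D = \<Squnion>{C, D}"

definition bot_congruence :: "'a congruence" where
  "bot_congruence = generated_congruence {}"

lift_definition top_congruence :: "'a congruence" is UNIV
  by (rule frame_congruence_UNIV)

instance
proof
  fix C D E :: "'a congruence" and \<C> :: "'a congruence set"
  show "C < D \<longleftrightarrow> C \<le> D \<and> \<not> D \<le> C" by (rule less_congruence_def)
  show "C \<le> C" by transfer auto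
  show "C \<le> D \<Longrightarrow> D \<le> E \<Longrightarrow> C \<le> E" by transfer auto
  show "C \<le> D \<Longrightarrow> D \<le> C \<Longrightarrow> C = D" by transfer auto
  have Inf1: "C \<in> \<C> \<Longrightarrow> \<Sqinter>\<C> \<le> C" for C :: "'a congruence" and \<C> by transfer auto
  have Inf2: "(\<And>C. C \<in> \<C> \<Longrightarrow> D \<le> C) \<Longrightarrow> D \<le> \<Sqinter>\<C>" for D :: "'a congruence" and \<C>
    by transfer auto
  have gen: "generated_congruence P \<le> D \<longleftrightarrow> P \<subseteq> rel_of D" for P and D :: "'a congruence"
    unfolding less_eq_congruence.rep_eq generated_congruence.rep_eq
    using frame_congruence_rel_of[of D] by blast
  have Sup1: "C \<le> \<Squnion>\<C>" if "C \<in> \<C>" for C :: "'a congruence" and \<C>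
  proof -
    have "\<Squnion>\<C> \<le> \<Squnion>\<C>" unfolding less_eq_congruence.rep_eq by (rule subset_refl)
    then have "(\<Union>(rel_of ` \<C>)) \<subseteq> rel_of (\<Squnion>\<C>)"
      using gen[of "\<Union>(rel_of ` \<C>)" "\<Squnion>\<C>"] by (simp add: Sup_congruence_def)
    then show ?thesis unfolding less_eq_congruence.rep_eq using that by blast
  qed
  have Sup2: "\<Squnion>\<C> \<le> D" if "\<And>C. C \<in> \<C> \<Longrightarrow> C \<le> D" for D :: "'a congruence" and \<C>
    unfolding Sup_congruence_def gen by (rule UN_least) (rule that[unfolded less_eq_congruence.rep_eq])
  show "C \<in> \<C> \<Longrightarrow> \<Sqinter>\<C> \<le> C" by (rule Inf1)
  show "(\<And>C. C \<in> \<C> \<Longrightarrow> D \<le> C) \<Longrightarrow> D \<le> \<Sqinter>\<C>" by (rule Inf2)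
  show "C \<in> \<C> \<Longrightarrow> C \<le> \<Squnion>\<C>" by (rule Sup1)
  show "(\<And>C. C \<in> \<C> \<Longrightarrow> C \<le> D) \<Longrightarrow> \<Squnion>\<C> \<le> D" by (rule Sup2)
  show "C \<sqinter> D \<le> C" "C \<sqinter> D \<le> D" unfolding inf_congruence_def by (auto intro: Inf1)
  show "E \<le> C \<Longrightarrow> E \<le> D \<Longrightarrow> E \<le> C \<sqinter> D" unfolding inf_congruence_def by (auto intro: Inf2)
  show "C \<le> C \<squnion> D" "D \<le> C \<squnion> D" unfolding sup_congruence_def by (auto intro: Sup1)
  show "C \<le> E \<Longrightarrow> D \<le> E \<Longrightarrow> C \<squnion> D \<le> E" unfolding sup_congruence_def by (auto intro: Sup2)
  show "\<Sqinter>({} :: 'a congruence set) = \<top>" by transfer simp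
  show "\<Squnion>({} :: 'a congruence set) = \<bottom>" by (simp add: Sup_congruence_def bot_congruence_def)
qed

end

lemma less_eq_congruence_iff: "C \<le> D \<longleftrightarrow> rel_of C \<subseteq> rel_of D"
  by (rule less_eq_congruence.rep_eq)

lemma rel_of_inf: "rel_of (C \<sqinter> D) = rel_of C \<inter> rel_of D"
  unfolding inf_congruence_def Inf_congruence.rep_eq by simp

lemma rel_of_top: "rel_of \<top> = UNIV"
  by (rule top_congruence.rep_eq)

lemma rel_of_bot: "rel_of \<bottom> = Id"
proof -
  have "frame_congruence (Id :: ('a \<times> 'a) set)"
  proof (rule frame_congruenceI)
    fix P :: "('a \<times> 'a) set"
    assume "P \<subseteq> Id"
    then have "fst ` P = snd ` P" by (intro image_cong) auto
    then show "(\<Squnion>(fst ` P), \<Squnion>(snd ` P)) \<in> Id" by simp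
  qed auto
  moreover have "Id \<subseteq> R" if "frame_congruence R" for R :: "('a \<times> 'a) set"
    using that frame_congruence_refl by auto
  ultimately show ?thesis
    unfolding bot_congruence_def generated_congruence.rep_eq by blast
qed

lemma generated_congruence_le_iff: "generated_congruence P \<le> C \<longleftrightarrow> P \<subseteq> rel_of C"
  unfolding less_eq_congruence.rep_eq generated_congruence.rep_eq
  using frame_congruence_rel_of[of C] by blast

lemma frame_congruence_impl:
  fixes A C :: "('a::frame \<times> 'a) set"
  assumes C: "frame_congruence C"
  shows "frame_congruence
    {(x, y). \<forall>a b. (a, b) \<in> A \<longrightarrow> a \<le> b \<longrightarrow> ((x \<squnion> a) \<sqinter> b, (y \<squnion> a) \<sqinter> b) \<in> C}"
    (is "frame_congruence ?R")
proof (rule frame_congruenceI)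
  show "(x, x) \<in> ?R" for x by (auto intro: frame_congruence_refl[OF C])
  show "(x, y) \<in> ?R \<Longrightarrow> (y, x) \<in> ?R" for x y by (auto intro: frame_congruence_sym[OF C])
  show "(x, y) \<in> ?R \<Longrightarrow> (y, z) \<in> ?R \<Longrightarrow> (x, z) \<in> ?R" for x y z
    using frame_congruence_trans[OF C] by blast
  have *: "((x \<sqinter> u) \<squnion> a) \<sqinter> b = ((x \<squnion> a) \<sqinter> b) \<sqinter> ((u \<squnion> a) \<sqinter> b)" for x u a b :: 'a
    by (simp add: sup_inf_distrib2 inf_aci)
  show "(x, y) \<in> ?R \<Longrightarrow> (u, v) \<in> ?R \<Longrightarrow> (x \<sqinter> u, y \<sqinter> v) \<in> ?R" for x y u v
    by (clarsimp simp only: mem_Collect_eq prod.case *) (rule frame_congruence_inf[OF C]; blast)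
  fix P
  assume P: "P \<subseteq> ?R"
  show "(\<Squnion>(fst ` P), \<Squnion>(snd ` P)) \<in> ?R"
  proof (clarsimp)
    fix a b
    assume ab: "(a, b) \<in> A" "a \<le> b"
    have eq: "(\<Squnion>(f ` P) \<squnion> a) \<sqinter> b = \<Squnion>((\<lambda>p. (f p \<squnion> a) \<sqinter> b) ` P) \<squnion> a"
      for f :: "'a \<times> 'a \<Rightarrow> 'a"
    proof -
      have dist: "(x \<squnion> a) \<sqinter> b = (b \<sqinter> x) \<squnion> a" for x
        using ab(2) by (simp add: inf_sup_distrib1 inf_absorb2 inf_commute[of _ b])
      have "(\<Squnion>(f ` P) \<squnion> a) \<sqinter> b = (\<Squnion>p\<in>P. b \<sqinter> f p) \<squnion> a"
        by (simp add: dist inf_Sup_frame image_comp comp_def)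
      also have "\<dots> = (\<Squnion>p\<in>P. (b \<sqinter> f p) \<squnion> a) \<squnion> a"
        by (intro antisym sup_least SUP_least) (auto intro: SUP_upper le_supI1 SUP_upper2)
      finally show ?thesis by (simp add: dist)
    qed
    let ?Q = "(\<lambda>p. ((fst p \<squnion> a) \<sqinter> b, (snd p \<squnion> a) \<sqinter> b)) ` P"
    have "?Q \<subseteq> C" using P ab by fastforce
    then have "(\<Squnion>(fst ` ?Q), \<Squnion>(snd ` ?Q)) \<in> C" by (rule frame_congruence_Sup[OF C])
    then have "(\<Squnion>((\<lambda>p. (fst p \<squnion> a) \<sqinter> b) ` P), \<Squnion>((\<lambda>p. (snd p \<squnion> a) \<sqinter> b) ` P)) \<in> C"
      by (simp add: image_image)
    then show "((\<Squnion>(fst ` P) \<squnion> a) \<sqinter> b, (\<Squnion>(snd ` P) \<squnion> a) \<sqinter> b) \<in> C"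
      unfolding eq by (rule frame_congruence_sup[OF C]) (rule frame_congruence_refl[OF C])
  qed
qed

instance congruence :: (frame) frame
proof
  fix A :: "'a congruence" and \<B> :: "'a congruence set"
  let ?C = "\<Squnion>B\<in>\<B>. A \<sqinter> B"
  note A = frame_congruence_rel_of[of A]
  define H where "H = Congruence {(x, y). \<forall>a b. (a, b) \<in> rel_of A \<longrightarrow> a \<le> b \<longrightarrow>
    ((x \<squnion> a) \<sqinter> b, (y \<squnion> a) \<sqinter> b) \<in> rel_of ?C}"
  have H: "rel_of H = {(x, y). \<forall>a b. (a, b) \<in> rel_of A \<longrightarrow> a \<le> b \<longrightarrow>
    ((x \<squnion> a) \<sqinter> b, (y \<squnion> a) \<sqinter> b) \<in> rel_of ?C}"
    unfolding H_def
    by (rule Congruence_inverse) (simp add: frame_congruence_impl frame_congruence_rel_of)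
  have "B \<le> H" if "B \<in> \<B>" for B
    unfolding less_eq_congruence_iff
  proof (clarsimp simp: H)
    note B = frame_congruence_rel_of[of B]
    fix x y a b
    assume xy: "(x, y) \<in> rel_of B" and ab: "(a, b) \<in> rel_of A" "a \<le> b"
    have b: "((x \<squnion> a) \<sqinter> b, (y \<squnion> a) \<sqinter> b) \<in> rel_of B"
      by (intro frame_congruence_inf[OF B] frame_congruence_sup[OF B]
          frame_congruence_refl[OF B] xy)
    have "((z \<squnion> a) \<sqinter> b, (z \<squnion> a) \<sqinter> a) \<in> rel_of A" for z
      by (rule frame_congruence_inf[OF A frame_congruence_refl[OF A]
            frame_congruence_sym[OF A ab(1)]])
    moreover have "(z \<squnion> a) \<sqinter> a = a" for z by (simp add: inf_absorb2)
    ultimately have "((z \<squnion> a) \<sqinter> b, a) \<in> rel_of A" for z by metis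
    then have "((x \<squnion> a) \<sqinter> b, (y \<squnion> a) \<sqinter> b) \<in> rel_of A"
      using frame_congruence_trans[OF A] frame_congruence_sym[OF A] by blast
    with b have "((x \<squnion> a) \<sqinter> b, (y \<squnion> a) \<sqinter> b) \<in> rel_of (A \<sqinter> B)"
      by (simp add: rel_of_inf)
    moreover have "A \<sqinter> B \<le> ?C" using that by (rule SUP_upper)
    ultimately show "((x \<squnion> a) \<sqinter> b, (y \<squnion> a) \<sqinter> b) \<in> rel_of ?C"
      unfolding less_eq_congruence_iff by blast
  qed
  then have S: "\<Squnion>\<B> \<le> H" by (rule Sup_least)
  note C = frame_congruence_rel_of[of ?C]
  have "A \<sqinter> H \<le> ?C"
    unfolding less_eq_congruence_iff
  proof (clarsimp simp: rel_of_inf)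
    fix x y
    assume xy: "(x, y) \<in> rel_of A" "(x, y) \<in> rel_of H"
    have "(x \<sqinter> y, y) \<in> rel_of A" "(x \<sqinter> y, x) \<in> rel_of A"
      using frame_congruence_inf[OF A xy(1) frame_congruence_refl[OF A, of y]]
        frame_congruence_inf[OF A frame_congruence_refl[OF A, of x] frame_congruence_sym[OF A xy(1)]]
      by simp_all
    moreover have "((x \<squnion> a) \<sqinter> b, (y \<squnion> a) \<sqinter> b) \<in> rel_of ?C"
      if "(a, b) \<in> rel_of A" "a \<le> b" for a b
      using xy(2) that unfolding H by blast
    ultimately have "((x \<squnion> (x \<sqinter> y)) \<sqinter> y, (y \<squnion> (x \<sqinter> y)) \<sqinter> y) \<in> rel_of ?C"
       "((x \<squnion> (x \<sqinter> y)) \<sqinter> x, (y \<squnion> (x \<sqinter> y)) \<sqinter> x) \<in> rel_of ?C"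
      using inf_le1 inf_le2 by blast+
    then have "(x \<sqinter> y, y) \<in> rel_of ?C" "(x, x \<sqinter> y) \<in> rel_of ?C"
      by (simp_all add: sup_absorb1 sup_absorb2 inf_commute)
    then show "(x, y) \<in> rel_of ?C" using frame_congruence_trans[OF C] by blast
  qed
  moreover have "A \<sqinter> \<Squnion>\<B> \<le> A \<sqinter> H" using S by (rule inf_mono[OF order_refl])
  ultimately have "A \<sqinter> \<Squnion>\<B> \<le> ?C" by (rule order_trans[rotated])
  then show "A \<sqinter> \<Squnion>\<B> = ?C"
    by (rule antisym) (rule SUP_least, rule inf_mono[OF order_refl], rule Sup_upper)
qed

definition nabla :: "'a::frame \<Rightarrow> 'a congruence" (\<open>\<nabla>\<close>) where
  "\<nabla> a = generated_congruence {(\<bottom>, a)}"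

definition dense_congruence :: "'a::frame congruence \<Rightarrow> bool" where
  "dense_congruence C \<longleftrightarrow> (\<forall>x. (\<bottom>, x) \<in> rel_of C \<longrightarrow> x = \<bottom>)"

lift_definition clear_congruence_of :: "'a::frame \<Rightarrow> 'a congruence" (\<open>\<partial>\<close>) is
  "\<lambda>c. {(x, y). \<forall>z. x \<sqinter> z \<le> c \<longleftrightarrow> y \<sqinter> z \<le> c}"
proof (rule frame_congruenceI)
  fix c :: 'a and P
  let ?R = "\<lambda>c. {(x :: 'a, y). \<forall>z. x \<sqinter> z \<le> c \<longleftrightarrow> y \<sqinter> z \<le> c}"
  show "(x, x) \<in> ?R c" for x by auto
  show "(x, y) \<in> ?R c \<Longrightarrow> (y, x) \<in> ?R c" for x y by auto
  show "(x, y) \<in> ?R c \<Longrightarrow> (y, z) \<in> ?R c \<Longrightarrow> (x, z) \<in> ?R c" for x y z by auto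
  show "(x, y) \<in> ?R c \<Longrightarrow> (u, v) \<in> ?R c \<Longrightarrow> (x \<sqinter> u, y \<sqinter> v) \<in> ?R c" for x y u v
    by (clarsimp) (metis inf.assoc inf.commute)
  assume P: "P \<subseteq> ?R c"
  have *: "\<Squnion>(f ` P) \<sqinter> z \<le> c \<longleftrightarrow> (\<forall>p\<in>P. f p \<sqinter> z \<le> c)" for f :: "'a \<times> 'a \<Rightarrow> 'a" and z
    by (simp add: inf_commute[of _ z] inf_Sup_frame image_image SUP_le_iff)
  show "(\<Squnion>(fst ` P), \<Squnion>(snd ` P)) \<in> ?R c"
    using P by (fastforce simp: *)
qed

definition clear_congruence :: "'a::frame congruence \<Rightarrow> bool" where
  "clear_congruence C \<longleftrightarrow> (\<exists>c. C = \<partial> c)"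

lift_definition largest_dense_congruence :: "'a::frame congruence" (\<open>\<DD>\<close>) is
  "{(x, y). \<forall>z. x \<sqinter> z = \<bottom> \<longleftrightarrow> y \<sqinter> z = \<bottom>}"
proof -
  show "frame_congruence {(x :: 'a, y). \<forall>z. x \<sqinter> z = \<bottom> \<longleftrightarrow> y \<sqinter> z = \<bottom>}"
    using frame_congruence_rel_of[of "\<partial> (\<bottom> :: 'a)"]
    by (simp add: clear_congruence_of.rep_eq le_bot bot_unique)
qed

lemma largest_dense_congruence_is_greatest:
  "dense_congruence \<DD>" "dense_congruence C \<Longrightarrow> C \<le> \<DD>"
proof -
  show "dense_congruence \<DD>"
    unfolding dense_congruence_def largest_dense_congruence.rep_eq by (auto dest: spec[of _ \<top>])
  assume D: "dense_congruence C"
  note C = frame_congruence_rel_of[of C]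
  have "y \<sqinter> z = \<bottom>" if "(x, y) \<in> rel_of C" "x \<sqinter> z = \<bottom>" for x y z
    using frame_congruence_inf[OF C that(1) frame_congruence_refl[OF C, of z]] that(2) D
    by (simp add: dense_congruence_def)
  then show "C \<le> \<DD>"
    unfolding less_eq_congruence_iff largest_dense_congruence.rep_eq
    using frame_congruence_sym[OF C] by blast
qed

definition prime_element :: "'a::frame \<Rightarrow> bool" where
  "prime_element p \<longleftrightarrow> p \<noteq> \<top> \<and> (\<forall>a b. a \<sqinter> b \<le> p \<longrightarrow> a \<le> p \<or> b \<le> p)"

definition spectrum_open :: "'a::frame \<Rightarrow> 'a set" where
  "spectrum_open a = {p. prime_element p \<and> \<not> a \<le> p}"

definition spectrum :: "'a::frame topology" where
  "spectrum = topology (\<lambda>U. \<exists>a. U = spectrum_open a)"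

lemma spectrum_open_bot: "spectrum_open \<bottom> = {}"
  by (simp add: spectrum_open_def)

lemma spectrum_open_top: "spectrum_open \<top> = {p. prime_element p}"
  by (auto simp: spectrum_open_def prime_element_def top_unique)

lemma spectrum_open_inf: "spectrum_open (a \<sqinter> b) = spectrum_open a \<inter> spectrum_open b"
  by (auto simp: spectrum_open_def prime_element_def intro: le_infI1 le_infI2)

lemma spectrum_open_Sup: "spectrum_open (\<Squnion>A) = \<Union>(spectrum_open ` A)"
  by (auto simp: spectrum_open_def Sup_le_iff)

lemma openin_spectrum: "openin spectrum U \<longleftrightarrow> (\<exists>a. U = spectrum_open a)"
proof -
  have "istopology (\<lambda>U. \<exists>a :: 'a. U = spectrum_open a)"
    unfolding istopology_def
  proof (intro conjI allI impI)
    fix S T :: "'a set"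
    assume "\<exists>a. S = spectrum_open a" "\<exists>a. T = spectrum_open a"
    then show "\<exists>a. S \<inter> T = spectrum_open a" by (metis spectrum_open_inf)
  next
    fix \<K> :: "'a set set"
    assume "\<forall>K\<in>\<K>. \<exists>a. K = spectrum_open a"
    then obtain f where "\<forall>K\<in>\<K>. K = spectrum_open (f K)" by metis
    then have "\<Union>\<K> = spectrum_open (\<Squnion>(f ` \<K>))" by (auto simp: spectrum_open_Sup)
    then show "\<exists>a. \<Union>\<K> = spectrum_open a" by blast
  qed
  then show ?thesis unfolding spectrum_def by simp
qed

lemma topspace_spectrum: "topspace spectrum = {p. prime_element p}"
proof -
  have "spectrum_open a \<subseteq> {p. prime_element p}" for a :: 'a
    by (auto simp: spectrum_open_def)
  then show ?thesis
    unfolding topspace_def openin_spectrum using spectrum_open_top[where 'a = 'a] by blast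
qed

definition spatial :: "'a::frame itself \<Rightarrow> bool" where
  "spatial (_ :: 'a itself) \<longleftrightarrow> inj (spectrum_open :: 'a \<Rightarrow> 'a set)"

definition skula_topology :: "'a topology \<Rightarrow> 'a topology" where
  "skula_topology X =
     topology_generated_by ({U. openin X U} \<union> {topspace X - U | U. openin X U})"

definition TD_space :: "'a topology \<Rightarrow> bool" where
  "TD_space X \<longleftrightarrow> (\<forall>x\<in>topspace X. \<exists>U. openin X U \<and> x \<in> U \<and> openin X (U - {x}))"

definition irreducible_closed :: "'a topology \<Rightarrow> 'a set \<Rightarrow> bool" where
  "irreducible_closed X C \<longleftrightarrow>
     closedin X C \<and> C \<noteq> {} \<and>
     (\<forall>D E. closedin X D \<longrightarrow> closedin X E \<longrightarrow> C = D \<union> E \<longrightarrow> C = D \<or> C = E)"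

definition sober_space :: "'a topology \<Rightarrow> bool" where
  "sober_space X \<longleftrightarrow>
     (\<forall>C. irreducible_closed X C \<longrightarrow> (\<exists>!x. x \<in> topspace X \<and> C = X closure_of {x}))"

text \<open>Frame homomorphisms from a frame to the frame of opens of \<open>X\<close>, whose finite meets are
  intersections (with empty meet \<open>topspace X\<close>) and whose joins are unions.\<close>

definition frame_hom_to_opens :: "'b topology \<Rightarrow> ('a::frame \<Rightarrow> 'b set) \<Rightarrow> bool" where
  "frame_hom_to_opens X f \<longleftrightarrow>
     (\<forall>a. openin X (f a)) \<and>
     f \<top> = topspace X \<and> (\<forall>a b. f (a \<sqinter> b) = f a \<inter> f b) \<and> (\<forall>A. f (\<Squnion>A) = \<Union>(f ` A))"

text \<open>A sober space with frame of opens isomorphic to \<open>'a\<close> is homeomorphic to the spectrum, a space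
  with points of type \<open>'a\<close>; so existence of such a space may be stated over \<open>'a topology\<close>.\<close>

definition iso_to_opens :: "'a::frame itself \<Rightarrow> 'b topology \<Rightarrow> bool" where
  "iso_to_opens (_ :: 'a itself) X \<longleftrightarrow>
     (\<exists>f :: 'a \<Rightarrow> 'b set. frame_hom_to_opens X f \<and> bij_betw f UNIV {U. openin X U})"

lemma frame_congruence_kernel:
  assumes "frame_hom_to_opens X f"
  shows "frame_congruence {(a, b). f a = f b}"
proof (rule frame_congruenceI)
  fix P
  assume "P \<subseteq> {(a, b). f a = f b}"
  then have "f ` fst ` P = f ` snd ` P"
    unfolding image_image by (intro image_cong) auto
  then show "(\<Squnion>(fst ` P), \<Squnion>(snd ` P)) \<in> {(a, b). f a = f b}"
    using assms by (simp add: frame_hom_to_opens_def)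
qed (use assms in \<open>auto simp: frame_hom_to_opens_def\<close>)

definition to_skula :: "'a::frame congruence \<Rightarrow> 'a set" where
  "to_skula = (THE f. frame_hom_to_opens (skula_topology spectrum) f \<and>
                      (\<forall>a. f (\<nabla> a) = spectrum_open a))"

lemma openin_skula:
  assumes "openin X U" "openin X V"
  shows "openin (skula_topology X) (U - V)"
proof -
  have "openin (skula_topology X) U" "openin (skula_topology X) (topspace X - V)"
    unfolding skula_topology_def using assms by (auto intro!: topology_generated_by_Basis)
  then have "openin (skula_topology X) (U \<inter> (topspace X - V))" by (rule openin_Int)
  moreover have "U \<inter> (topspace X - V) = U - V" using openin_subset[OF assms(1)] by auto
  ultimately show ?thesis by simp
qed

lemma topspace_skula: "topspace (skula_topology X) = topspace X"
  unfolding skula_topology_def topology_generated_by_topspace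
  using openin_subset by fastforce

lemma prime_kernel:
  assumes "prime_element p"
  shows "frame_congruence {(x, y). x \<le> p \<longleftrightarrow> y \<le> p}"
proof (rule frame_congruenceI)
  have *: "a \<sqinter> b \<le> p \<longleftrightarrow> a \<le> p \<or> b \<le> p" for a b
    using assms by (auto simp: prime_element_def intro: le_infI1 le_infI2)
  show "(a \<sqinter> c, b \<sqinter> d) \<in> {(x, y). x \<le> p \<longleftrightarrow> y \<le> p}"
    if "(a, b) \<in> {(x, y). x \<le> p \<longleftrightarrow> y \<le> p}" "(c, d) \<in> {(x, y). x \<le> p \<longleftrightarrow> y \<le> p}" for a b c d
    using that by (auto simp: *)
qed (auto simp: Sup_le_iff, fastforce+)

lemma to_skula_exists:
  "\<exists>f. frame_hom_to_opens (skula_topology spectrum) f \<and> (\<forall>a :: 'a::frame. f (\<nabla> a) = spectrum_open a)"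
proof -
  define K :: "'a \<Rightarrow> 'a congruence" where "K p = Congruence {(x, y). x \<le> p \<longleftrightarrow> y \<le> p}" for p
  have K: "rel_of (K p) = {(x, y). x \<le> p \<longleftrightarrow> y \<le> p}" if "prime_element p" for p
    unfolding K_def by (rule Congruence_inverse) (simp add: prime_kernel that)
  define f where "f C = {p. prime_element p \<and> \<not> C \<le> K p}" for C
  have mem: "p \<in> f C \<longleftrightarrow> prime_element p \<and> (\<exists>x y. (x, y) \<in> rel_of C \<and> x \<le> p \<and> \<not> y \<le> p)" for p C
    unfolding f_def using frame_congruence_sym[OF frame_congruence_rel_of[of C]]
    by (simp add: less_eq_congruence_iff K subset_iff cong: conj_cong) blast
  have up: "\<exists>x y. (x, y) \<in> rel_of C \<and> x \<le> y \<and> x \<le> p \<and> \<not> y \<le> p" if pC: "p \<in> f C" for p C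
  proof -
    obtain x y where xy: "(x, y) \<in> rel_of C" "x \<le> p" "\<not> y \<le> p" using pC unfolding mem by blast
    note C = frame_congruence_rel_of[of C]
    have "(x \<squnion> x, x \<squnion> y) \<in> rel_of C"
      by (rule frame_congruence_sup[OF C frame_congruence_refl[OF C] xy(1)])
    with xy have "(x, x \<squnion> y) \<in> rel_of C \<and> x \<le> x \<squnion> y \<and> x \<le> p \<and> \<not> x \<squnion> y \<le> p" by simp
    then show ?thesis by blast
  qed
  have nab: "f (\<nabla> a) = spectrum_open a" for a
    by (auto simp: f_def spectrum_open_def nabla_def generated_congruence_le_iff K)
  have "openin (skula_topology spectrum) (f C)" for C
  proof (subst openin_subopen, intro ballI)
    fix p
    assume p: "p \<in> f C"
    then obtain x y where xy: "(x, y) \<in> rel_of C" "x \<le> p" "\<not> y \<le> p" unfolding mem by blast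
    show "\<exists>T. openin (skula_topology spectrum) T \<and> p \<in> T \<and> T \<subseteq> f C"
    proof (intro exI conjI)
      show "openin (skula_topology spectrum) (spectrum_open y - spectrum_open x)"
        by (rule openin_skula) (auto simp: openin_spectrum)
      show "p \<in> spectrum_open y - spectrum_open x"
        using p xy by (auto simp: spectrum_open_def f_def)
      show "spectrum_open y - spectrum_open x \<subseteq> f C"
        using xy(1) by (auto simp: spectrum_open_def mem)
    qed
  qed
  moreover have "f \<top> = topspace (skula_topology spectrum)"
    unfolding topspace_skula topspace_spectrum
    by (auto simp: mem rel_of_top) (use prime_element_def top_unique in blast)+
  moreover have "f (\<Squnion>\<C>) = \<Union>(f ` \<C>)" for \<C>
    by (auto simp: f_def Sup_le_iff)
  moreover have "f (C \<sqinter> D) = f C \<inter> f D" for C D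
  proof
    show "f (C \<sqinter> D) \<subseteq> f C \<inter> f D" by (auto simp: f_def intro: le_infI1 le_infI2)
    show "f C \<inter> f D \<subseteq> f (C \<sqinter> D)"
    proof clarify
      fix p
      assume p: "p \<in> f C" "p \<in> f D"
      obtain x y where xy: "(x, y) \<in> rel_of C" "x \<le> y" "x \<le> p" "\<not> y \<le> p"
        using up[OF p(1)] by blast
      obtain u v where uv: "(u, v) \<in> rel_of D" "u \<le> v" "u \<le> p" "\<not> v \<le> p"
        using up[OF p(2)] by blast
      note C = frame_congruence_rel_of[of C] and D = frame_congruence_rel_of[of D]
      have pr: "prime_element p" using p by (simp add: f_def)
      have "((x \<sqinter> v) \<squnion> (u \<sqinter> y), (y \<sqinter> v) \<squnion> (u \<sqinter> y)) \<in> rel_of C"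
        by (intro frame_congruence_sup[OF C] frame_congruence_inf[OF C]
            frame_congruence_refl[OF C] xy)
      moreover have "(y \<sqinter> v) \<squnion> (u \<sqinter> y) = y \<sqinter> v"
        using uv(2) by (metis inf.commute inf_mono order_refl sup_absorb1)
      moreover have "((x \<sqinter> v) \<squnion> (u \<sqinter> y), (x \<sqinter> v) \<squnion> (v \<sqinter> y)) \<in> rel_of D"
        by (intro frame_congruence_sup[OF D] frame_congruence_inf[OF D]
            frame_congruence_refl[OF D] uv)
      moreover have "(x \<sqinter> v) \<squnion> (v \<sqinter> y) = y \<sqinter> v"
        using xy(2) by (metis inf.commute inf_mono order_refl sup_absorb2)
      ultimately have "((x \<sqinter> v) \<squnion> (u \<sqinter> y), y \<sqinter> v) \<in> rel_of (C \<sqinter> D)"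
        by (simp add: rel_of_inf)
      moreover have "(x \<sqinter> v) \<squnion> (u \<sqinter> y) \<le> p" using xy(3) uv(3) by (auto intro: le_infI1)
      moreover have "\<not> y \<sqinter> v \<le> p" using pr xy(4) uv(4) by (auto simp: prime_element_def)
      ultimately show "p \<in> f (C \<sqinter> D)" using pr unfolding mem by blast
    qed
  qed
  ultimately show ?thesis using nab unfolding frame_hom_to_opens_def by blast
qed

lemma nabla_inf_delta_le:
  assumes xy: "(x, y) \<in> rel_of C" "x \<le> y"
  shows "\<nabla> y \<sqinter> generated_congruence {(x, \<top>)} \<le> C"
proof -
  have n: "frame_congruence {(u, v). u \<squnion> y = v \<squnion> y}" (is "frame_congruence ?N")
  proof (rule frame_congruenceI)
    fix P assume P: "P \<subseteq> ?N"
    have *: "\<Squnion>(f ` P) \<squnion> y = \<Squnion>((\<lambda>p. f p \<squnion> y) ` P) \<squnion> y" for f :: "'a \<times> 'a \<Rightarrow> 'a"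
      by (intro antisym sup_least SUP_least) (auto intro: SUP_upper le_supI1 SUP_upper2)
    have "(\<lambda>p. fst p \<squnion> y) ` P = (\<lambda>p. snd p \<squnion> y) ` P" using P by (intro image_cong) auto
    then show "(\<Squnion>(fst ` P), \<Squnion>(snd ` P)) \<in> ?N"
      by (simp only: mem_Collect_eq prod.case *[of fst] *[of snd])
  qed (auto simp: sup_inf_distrib2)
  have d: "frame_congruence {(u, v). x \<sqinter> u = x \<sqinter> v}" (is "frame_congruence ?D")
  proof (rule frame_congruenceI)
    fix P assume P: "P \<subseteq> ?D"
    have "(\<lambda>p. x \<sqinter> fst p) ` P = (\<lambda>p. x \<sqinter> snd p) ` P" using P by (intro image_cong) auto
    then show "(\<Squnion>(fst ` P), \<Squnion>(snd ` P)) \<in> ?D" by (simp add: inf_Sup_frame image_image)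
  next
    show "(a, b) \<in> ?D \<Longrightarrow> (c, d) \<in> ?D \<Longrightarrow> (a \<sqinter> c, b \<sqinter> d) \<in> ?D" for a b c d
      by simp (metis inf.assoc inf.commute)
  qed auto
  have N: "rel_of (\<nabla> y) \<subseteq> ?N"
    unfolding nabla_def generated_congruence.rep_eq by (rule Inter_lower) (simp add: n)
  have D: "rel_of (generated_congruence {(x, \<top>)}) \<subseteq> ?D"
    unfolding generated_congruence.rep_eq by (rule Inter_lower) (simp add: d)
  note C = frame_congruence_rel_of[of C]
  have half: "(u, u \<sqinter> v) \<in> rel_of C" if uv: "u \<squnion> y = v \<squnion> y" "x \<sqinter> u = x \<sqinter> v" for u v
  proof -
    have 1: "(u \<sqinter> v) \<squnion> (u \<sqinter> y) = u"
      using uv(1) by (metis inf_sup_absorb inf_sup_distrib1)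
    have 2: "(u \<sqinter> v) \<squnion> (u \<sqinter> x) = u \<sqinter> v"
      using uv(2) by (metis inf.commute inf.cobounded2 inf.boundedI inf.cobounded1 sup_absorb1)
    have "((u \<sqinter> v) \<squnion> (u \<sqinter> y), (u \<sqinter> v) \<squnion> (u \<sqinter> x)) \<in> rel_of C"
      by (rule frame_congruence_sup[OF C frame_congruence_refl[OF C]
            frame_congruence_inf[OF C frame_congruence_refl[OF C] frame_congruence_sym[OF C xy(1)]]])
    then show ?thesis by (simp add: 1 2)
  qed
  show ?thesis
    unfolding less_eq_congruence_iff rel_of_inf
  proof clarify
    fix u v
    assume "(u, v) \<in> rel_of (\<nabla> y)" "(u, v) \<in> rel_of (generated_congruence {(x, \<top>)})"
    then have uv: "u \<squnion> y = v \<squnion> y" "x \<sqinter> u = x \<sqinter> v" using N D by auto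
    have "(u, u \<sqinter> v) \<in> rel_of C" "(v, u \<sqinter> v) \<in> rel_of C"
      using half[OF uv] half[OF uv[symmetric]] by (simp_all add: inf_commute)
    then show "(u, v) \<in> rel_of C"
      using frame_congruence_trans[OF C] frame_congruence_sym[OF C] by blast
  qed
qed

lemma congruence_eq_Sup:
  fixes C :: "'a::frame congruence"
  shows "C = \<Squnion>{\<nabla> y \<sqinter> generated_congruence {(x, \<top>)} | x y. (x, y) \<in> rel_of C \<and> x \<le> y}"
    (is "C = ?S")
proof (rule antisym)
  show "?S \<le> C" by (rule Sup_least) (auto intro: nabla_inf_delta_le)
  note C = frame_congruence_rel_of[of C] and S = frame_congruence_rel_of[of ?S]
  have le: "(x, y) \<in> rel_of ?S" if "(x, y) \<in> rel_of C" "x \<le> y" for x y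
  proof -
    let ?N = "\<nabla> y" and ?D = "generated_congruence {(x, \<top>)}"
    note fN = frame_congruence_rel_of[of ?N] and fD = frame_congruence_rel_of[of ?D]
    have "(\<bottom>, y) \<in> rel_of ?N" "(x, \<top>) \<in> rel_of ?D"
      using generated_congruence_le_iff[of "{(\<bottom>, y)}" ?N]
        generated_congruence_le_iff[of "{(x, \<top>)}" ?D] by (auto simp: nabla_def)
    then have "(x \<squnion> \<bottom>, x \<squnion> y) \<in> rel_of ?N" "(x \<sqinter> y, \<top> \<sqinter> y) \<in> rel_of ?D"
      using frame_congruence_sup[OF fN frame_congruence_refl[OF fN, of x], of \<bottom> y]
        frame_congruence_inf[OF fD _ frame_congruence_refl[OF fD, of y], of x \<top>] by blast+
    then have "(x, y) \<in> rel_of (?N \<sqinter> ?D)"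
      using that(2) by (simp add: rel_of_inf sup_absorb2 inf_absorb1)
    moreover have "?N \<sqinter> ?D \<le> ?S" using that by (intro Sup_upper) blast
    ultimately show ?thesis unfolding less_eq_congruence_iff by blast
  qed
  show "C \<le> ?S"
    unfolding less_eq_congruence_iff
  proof clarify
    fix x y
    assume xy: "(x, y) \<in> rel_of C"
    have "(x, x \<squnion> y) \<in> rel_of C" "(y, x \<squnion> y) \<in> rel_of C"
      using frame_congruence_sup[OF C frame_congruence_refl[OF C, of x] xy]
        frame_congruence_sup[OF C frame_congruence_sym[OF C xy] frame_congruence_refl[OF C, of y]]
      by simp_all
    then have "(x, x \<squnion> y) \<in> rel_of ?S" "(y, x \<squnion> y) \<in> rel_of ?S" by (auto intro!: le)
    then show "(x, y) \<in> rel_of ?S"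
      using frame_congruence_trans[OF S] frame_congruence_sym[OF S] by blast
  qed
qed

lemma nabla_delta_complement:
  "\<nabla> a \<sqinter> generated_congruence {(a, \<top>)} = \<bottom>" "\<nabla> a \<squnion> generated_congruence {(a, \<top>)} = \<top>"
proof -
  show "\<nabla> a \<sqinter> generated_congruence {(a, \<top>)} = \<bottom>"
    using nabla_inf_delta_le[of a a \<bottom>] by (simp add: rel_of_bot bot_unique)
  let ?S = "\<nabla> a \<squnion> generated_congruence {(a, \<top>)}"
  note S = frame_congruence_rel_of[of ?S]
  have "(\<bottom>, a) \<in> rel_of ?S" "(a, \<top>) \<in> rel_of ?S"
    using generated_congruence_le_iff[of "{(\<bottom>, a)}" ?S]
      generated_congruence_le_iff[of "{(a, \<top>)}" ?S] by (auto simp: nabla_def)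
  then have bt: "(\<bottom>, \<top>) \<in> rel_of ?S" by (rule frame_congruence_trans[OF S])
  have "(\<bottom>, x) \<in> rel_of ?S" for x
    using frame_congruence_inf[OF S bt frame_congruence_refl[OF S, of x]] by simp
  then have "(x, y) \<in> rel_of ?S" for x y
    using frame_congruence_trans[OF S] frame_congruence_sym[OF S] by blast
  then have "\<top> \<le> ?S" unfolding less_eq_congruence_iff by auto
  then show "?S = \<top>" by (rule top_le)
qed

lemma frame_hom_from_congruence_unique:
  assumes f: "frame_hom_to_opens X f" and g: "frame_hom_to_opens X g"
    and eq: "\<And>a :: 'a::frame. f (\<nabla> a) = g (\<nabla> a)"
  shows "f = g"
proof
  fix C :: "'a congruence"
  have compl: "h (generated_congruence {(a, \<top>)}) = topspace X - h (\<nabla> a)"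
    if h: "frame_hom_to_opens X h" for h and a :: 'a
  proof -
    let ?D = "generated_congruence {(a, \<top>)}"
    have "h \<bottom> = {}" using h unfolding frame_hom_to_opens_def by (metis Sup_empty image_empty)
    then have "h (\<nabla> a) \<inter> h ?D = {}"
      using h nabla_delta_complement(1)[of a] unfolding frame_hom_to_opens_def by metis
    moreover have "h (\<Squnion>{\<nabla> a, ?D}) = h (\<nabla> a) \<union> h ?D"
      using h unfolding frame_hom_to_opens_def by (metis Union_insert Sup_empty image_insert image_empty sup_bot_right)
    then have "h (\<nabla> a) \<union> h ?D = topspace X"
      using h nabla_delta_complement(2)[of a] by (simp add: frame_hom_to_opens_def)
    ultimately show ?thesis by auto
  qed
  let ?P = "{\<nabla> y \<sqinter> generated_congruence {(x, \<top>)} | x y. (x, y) \<in> rel_of C \<and> x \<le> y}"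
  have "f E = g E" if "E \<in> ?P" for E
    using that f g compl[OF f] compl[OF g] eq by (auto simp: frame_hom_to_opens_def)
  then have "\<Union>(f ` ?P) = \<Union>(g ` ?P)" by (intro arg_cong[of _ _ Union] image_cong) auto
  then have "f (\<Squnion>?P) = g (\<Squnion>?P)" using f g unfolding frame_hom_to_opens_def by metis
  then show "f C = g C" using congruence_eq_Sup[of C] by simp
qed

lemma to_skula:
  fixes a :: "'a::frame"
  shows "frame_hom_to_opens (skula_topology spectrum) (to_skula :: 'a congruence \<Rightarrow> 'a set)"
    and "to_skula (\<nabla> a) = spectrum_open a"
proof -
  have "\<exists>!f. frame_hom_to_opens (skula_topology spectrum) f \<and>
      (\<forall>a :: 'a. f (\<nabla> a) = spectrum_open a)"
  proof (rule ex_ex1I[OF to_skula_exists], elim conjE)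
    fix f g :: "'a congruence \<Rightarrow> 'a set"
    assume "frame_hom_to_opens (skula_topology spectrum) f"
      "frame_hom_to_opens (skula_topology spectrum) g"
      "\<forall>a. f (\<nabla> a) = spectrum_open a" "\<forall>a. g (\<nabla> a) = spectrum_open a"
    then show "f = g" by (intro frame_hom_from_congruence_unique) auto
  qed
  from theI'[OF this, folded to_skula_def]
  show "frame_hom_to_opens (skula_topology spectrum) (to_skula :: 'a congruence \<Rightarrow> 'a set)"
    "to_skula (\<nabla> a) = spectrum_open a" by auto
qed

lift_definition skula_kernel :: "'a::frame congruence congruence" is
  "{(A, B). to_skula A = to_skula B}"
  by (rule frame_congruence_kernel[OF to_skula(1)])

unbundle no lattice_syntax

end

theory Submission
  imports Defs
begin

unbundle lattice_syntax

text \<open>Write \<open>\<sigma>\<close> for the map \<open>to_skula\<close> and \<open>S\<close> for its kernel. Everything rests on an explicit description of it: a prime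
  \<open>p\<close> lies in \<open>\<sigma> C\<close> iff \<open>C\<close> relates some \<open>x \<le> y\<close> that \<open>p\<close> separates, that is \<open>x \<le> p\<close> and
  \<open>\<not> y \<le> p\<close> (\<open>mem_to_skula_iff\<close>).

  \<^emph>\<open>Density.\<close> As \<open>\<DD>\<close> is the largest dense congruence, \<open>S \<le> \<DD>\<close> says that \<open>\<sigma> C = {}\<close> forces
  \<open>C = \<bottom>\<close>. By the description of \<open>\<sigma>\<close>, this means that primes separate any two distinct elements,
  which is spatiality (\<open>dense_skula_kernel_iff_spatial\<close>).

  \<^emph>\<open>Clearness.\<close> Let \<open>c\<close> be the largest congruence with \<open>\<sigma> c = {}\<close>. If \<open>S\<close> is clear, it has to be
  \<open>\<partial> c\<close>. The pair \<open>(A, B)\<close> lies in \<open>\<partial> c\<close> iff every \<open>\<sigma> Z\<close> disjoint from one of \<open>\<sigma> A\<close>, \<open>\<sigma> B\<close> is disjoint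
  from the other; so \<open>S = \<partial> c\<close> says that Skula open sets are determined by the Skula open sets
  that they meet. This holds iff the Skula topology is discrete: an open \<open>{p}\<close> tests the membership of
  \<open>p\<close>; conversely the complement of \<open>{p}\<close> is always Skula open, and a test telling it from the
  whole space can only be \<open>{p}\<close>. Finally \<open>{p}\<close> is Skula open iff it is a difference of two opens of
  the spectrum, which is the \<open>T\<^sub>D\<close> condition at \<open>p\<close> (\<open>clear_skula_kernel_if_TD\<close>,
  \<open>TD_if_clear_skula_kernel\<close>).

  \<^emph>\<open>Equality.\<close> Since \<open>\<DD> = \<partial> \<bottom>\<close> and \<open>\<partial> c\<close> is dense only for \<open>c = \<bottom>\<close>, the equation \<open>S = \<DD>\<close> holds iff
  \<open>S\<close> is both dense and clear, hence iff the frame is spatial with \<open>T\<^sub>D\<close> spectrum. Then the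
  spectrum, which is sober, is the required space; conversely the primes of the frame of opens of
  a sober space are its points, so that the \<open>T\<^sub>D\<close> property passes to the spectrum
  (\<open>TD_spectrum_if_iso_to_opens\<close>).\<close>

section \<open>The map to the Skula topology\<close>

abbreviation delta :: "'a::frame \<Rightarrow> 'a congruence" (\<open>\<Delta>\<close>) where
  "\<Delta> a \<equiv> generated_congruence {(a, \<top>)}"

lemma to_skula_top: "to_skula (\<top> :: 'a::frame congruence) = {p. prime_element p}"
  using to_skula(1)[where 'a = 'a]
  by (simp add: frame_hom_to_opens_def topspace_skula topspace_spectrum)

lemma to_skula_inf: "to_skula (C \<sqinter> D) = to_skula C \<inter> to_skula (D :: 'a::frame congruence)"
  using to_skula(1)[where 'a = 'a] by (simp add: frame_hom_to_opens_def)

lemma to_skula_Sup: "to_skula (\<Squnion>\<C>) = \<Union>(to_skula ` (\<C> :: 'a::frame congruence set))"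
  using to_skula(1)[where 'a = 'a] by (simp add: frame_hom_to_opens_def)

lemma to_skula_bot: "to_skula \<bottom> = {}"
  using to_skula_Sup[of "{}"] by simp

lemma to_skula_sup: "to_skula (C \<squnion> D) = to_skula C \<union> to_skula D"
  using to_skula_Sup[of "{C, D}"] by simp

lemma to_skula_delta: "to_skula (\<Delta> a) = {p. prime_element p \<and> a \<le> p}"
proof -
  have "to_skula (\<nabla> a) \<inter> to_skula (\<Delta> a) = {}"
    by (metis nabla_delta_complement(1) to_skula_inf to_skula_bot)
  moreover have "to_skula (\<nabla> a) \<union> to_skula (\<Delta> a) = {p. prime_element p}"
    by (metis nabla_delta_complement(2) to_skula_sup to_skula_top)
  ultimately show ?thesis
    unfolding to_skula(2) spectrum_open_def by blast
qed

lemma to_skula_nabla_inf_delta: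
  "to_skula (\<nabla> y \<sqinter> \<Delta> x) = {p. prime_element p \<and> x \<le> p \<and> \<not> y \<le> p}"
  unfolding to_skula_inf to_skula_delta to_skula(2) spectrum_open_def by blast

text \<open>A congruence is the join of the \<open>\<nabla> y \<sqinter> \<Delta> x\<close> over its pairs \<open>x \<le> y\<close>, and \<open>\<sigma>\<close> preserves joins.\<close>

lemma mem_to_skula_iff:
  "p \<in> to_skula C \<longleftrightarrow>
    prime_element p \<and> (\<exists>x y. (x, y) \<in> rel_of C \<and> x \<le> y \<and> x \<le> p \<and> \<not> y \<le> p)"
proof -
  let ?P = "{\<nabla> y \<sqinter> \<Delta> x | x y. (x, y) \<in> rel_of C \<and> x \<le> y}"
  have "p \<in> to_skula (\<Squnion>?P) \<longleftrightarrow>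
      (\<exists>x y. (x, y) \<in> rel_of C \<and> x \<le> y \<and> p \<in> to_skula (\<nabla> y \<sqinter> \<Delta> x))"
    unfolding to_skula_Sup by blast
  then show ?thesis
    unfolding congruence_eq_Sup[of C, symmetric] to_skula_nabla_inf_delta by blast
qed

lemma to_skula_prime: "p \<in> to_skula C \<Longrightarrow> prime_element p"
  by (simp add: mem_to_skula_iff)

lemma rel_of_nabla_inf_delta: "x \<le> y \<Longrightarrow> (x, y) \<in> rel_of (\<nabla> y \<sqinter> \<Delta> x)"
proof -
  note N = frame_congruence_rel_of[of "\<nabla> y"] and D = frame_congruence_rel_of[of "\<Delta> x"]
  assume xy: "x \<le> y"
  have "(\<bottom>, y) \<in> rel_of (\<nabla> y)" "(x, \<top>) \<in> rel_of (\<Delta> x)"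
    using generated_congruence_le_iff[of "{(\<bottom>, y)}" "\<nabla> y"]
      generated_congruence_le_iff[of "{(x, \<top>)}" "\<Delta> x"] by (auto simp: nabla_def)
  then have "(x \<squnion> \<bottom>, x \<squnion> y) \<in> rel_of (\<nabla> y)" "(x \<sqinter> y, \<top> \<sqinter> y) \<in> rel_of (\<Delta> x)"
    by (auto intro!: frame_congruence_sup[OF N] frame_congruence_inf[OF D] frame_congruence_refl N D
        simp del: sup_bot_right inf_top_left)
  then show ?thesis
    using xy by (simp add: rel_of_inf sup_absorb2 inf_absorb1)
qed

lemma rel_of_skula_kernel: "(A, B) \<in> rel_of skula_kernel \<longleftrightarrow> to_skula A = to_skula B"
  by (simp add: skula_kernel.rep_eq)

section \<open>Density and spatiality\<close>

lemma le_largest_dense_iff: "C \<le> \<DD> \<longleftrightarrow> dense_congruence C"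
  using largest_dense_congruence_is_greatest
  unfolding less_eq_congruence_iff dense_congruence_def by blast

lemma dense_skula_kernel_iff:
  "dense_congruence (skula_kernel :: 'a::frame congruence congruence) \<longleftrightarrow>
    (\<forall>C :: 'a congruence. to_skula C = {} \<longrightarrow> C = \<bottom>)"
  unfolding dense_congruence_def rel_of_skula_kernel to_skula_bot by blast

text \<open>If no prime tells \<open>x\<close> from \<open>y\<close>, then \<open>\<nabla> (x \<squnion> y) \<sqinter> \<Delta> x\<close> has empty image, so density collapses it and
  with it the pair \<open>(x, x \<squnion> y)\<close>. Conversely every pair of a congruence with empty image consists
  of elements that no prime separates.\<close>

lemma dense_skula_kernel_iff_spatial:
  "dense_congruence (skula_kernel :: 'a::frame congruence congruence) \<longleftrightarrow> spatial TYPE('a)"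
proof
  assume D: "dense_congruence (skula_kernel :: 'a congruence congruence)"
  have le: "y \<le> x" if "spectrum_open x = spectrum_open y" for x y :: 'a
  proof -
    let ?C = "\<nabla> (x \<squnion> y) \<sqinter> \<Delta> x"
    have "to_skula ?C = {}"
      unfolding to_skula_nabla_inf_delta using that by (auto simp: spectrum_open_def)
    then have "?C = \<bottom>" using D unfolding dense_skula_kernel_iff by blast
    moreover have "(x, x \<squnion> y) \<in> rel_of ?C" by (rule rel_of_nabla_inf_delta) simp
    ultimately have "x = x \<squnion> y" by (metis rel_of_bot IdD)
    then show ?thesis by (metis sup_ge2)
  qed
  show "spatial TYPE('a)"
    unfolding spatial_def by (rule injI) (metis le antisym)
next
  assume sp: "spatial TYPE('a)"
  show "dense_congruence (skula_kernel :: 'a congruence congruence)"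
    unfolding dense_skula_kernel_iff
  proof (intro allI impI)
    fix C :: "'a congruence"
    assume e: "to_skula C = {}"
    note C = frame_congruence_rel_of[of C]
    have up: "x = y" if "(x, y) \<in> rel_of C" "x \<le> y" for x y
    proof -
      have "x \<le> p \<longleftrightarrow> y \<le> p" if "prime_element p" for p
        using that \<open>(x, y) \<in> rel_of C\<close> \<open>x \<le> y\<close> e mem_to_skula_iff[of p C] by force
      then have "spectrum_open x = spectrum_open y" by (auto simp: spectrum_open_def)
      then show ?thesis using sp unfolding spatial_def by (rule injD[rotated])
    qed
    have "rel_of C \<subseteq> Id"
    proof clarify
      fix x y
      assume xy: "(x, y) \<in> rel_of C"
      have "x = x \<squnion> y" "y = x \<squnion> y"
        using up[of x "x \<squnion> y"] up[of y "x \<squnion> y"]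
          frame_congruence_sup[OF C frame_congruence_refl[OF C, of x] xy]
          frame_congruence_sup[OF C frame_congruence_sym[OF C xy] frame_congruence_refl[OF C, of y]]
        by simp_all
      then show "x = y" by metis
    qed
    then show "C = \<bottom>"
      using less_eq_congruence_iff[of C \<bottom>] by (simp add: rel_of_bot bot_unique)
  qed
qed

section \<open>Clear kernels and the separation axiom\<close>

lemma mem_clear_congruence_of_iff:
  "(x, y) \<in> rel_of (\<partial> c) \<longleftrightarrow> (\<forall>z. x \<sqinter> z \<le> c \<longleftrightarrow> y \<sqinter> z \<le> c)"
  by (simp add: clear_congruence_of.rep_eq)

lemma bot_clear_congruence_of_iff: "(\<bottom>, x) \<in> rel_of (\<partial> c) \<longleftrightarrow> x \<le> c"
proof
  assume "(\<bottom>, x) \<in> rel_of (\<partial> c)"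
  then have "\<bottom> \<sqinter> \<top> \<le> c \<longleftrightarrow> x \<sqinter> \<top> \<le> c" unfolding mem_clear_congruence_of_iff by blast
  then show "x \<le> c" by simp
qed (simp add: mem_clear_congruence_of_iff le_infI1)

text \<open>The \<open>T\<^sub>D\<close> condition at \<open>p\<close> makes \<open>{p}\<close> the image of some \<open>\<nabla> a \<sqinter> \<Delta> b\<close>, and meeting with it
  decides whether \<open>p\<close> belongs to an image.\<close>

lemma clear_skula_kernel_if_TD:
  assumes T: "TD_space (spectrum :: 'a::frame topology)"
  shows "clear_congruence (skula_kernel :: 'a congruence congruence)"
proof -
  define c where "c = \<Squnion>{C :: 'a congruence. to_skula C = {}}"
  have c: "to_skula C = {} \<longleftrightarrow> C \<le> c" for C
  proof
    assume "C \<le> c"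
    then have "to_skula C = to_skula C \<inter> to_skula c"
      by (metis inf.absorb1 to_skula_inf)
    moreover have "to_skula c = {}"
      unfolding c_def to_skula_Sup by auto
    ultimately show "to_skula C = {}" by simp
  qed (auto simp: c_def intro: Sup_upper)
  have sub: "to_skula A \<subseteq> to_skula B" if AB: "(A, B) \<in> rel_of (\<partial> c)" for A B
  proof
    fix p
    assume p: "p \<in> to_skula A"
    then have "p \<in> topspace spectrum" by (simp add: topspace_spectrum to_skula_prime)
    then obtain U where "openin spectrum U" "p \<in> U" "openin spectrum (U - {p})"
      using T unfolding TD_space_def by blast
    then obtain a b where ab: "p \<in> spectrum_open a" "spectrum_open a - {p} = spectrum_open b"
      unfolding openin_spectrum by metis
    let ?Z = "\<nabla> a \<sqinter> \<Delta> b"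
    have "q \<in> to_skula ?Z \<longleftrightarrow> q \<in> spectrum_open a - spectrum_open b" for q
      unfolding to_skula_nabla_inf_delta by (auto simp: spectrum_open_def)
    then have Z: "to_skula ?Z = {p}"
      using ab by blast
    then have "\<not> A \<sqinter> ?Z \<le> c"
      using p by (simp add: c[symmetric] to_skula_inf)
    then have "\<not> B \<sqinter> ?Z \<le> c"
      using AB by (simp add: mem_clear_congruence_of_iff)
    then show "p \<in> to_skula B"
      using Z by (simp add: c[symmetric] to_skula_inf)
  qed
  have "(A, B) \<in> rel_of skula_kernel \<longleftrightarrow> (A, B) \<in> rel_of (\<partial> c)" for A B
  proof
    assume "(A, B) \<in> rel_of skula_kernel"
    then show "(A, B) \<in> rel_of (\<partial> c)"
      by (simp add: rel_of_skula_kernel mem_clear_congruence_of_iff c[symmetric] to_skula_inf)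
  next
    assume AB: "(A, B) \<in> rel_of (\<partial> c)"
    then have "(B, A) \<in> rel_of (\<partial> c)" by (rule frame_congruence_sym[OF frame_congruence_rel_of])
    with AB show "(A, B) \<in> rel_of skula_kernel"
      unfolding rel_of_skula_kernel using sub by blast
  qed
  then have "rel_of skula_kernel = rel_of (\<partial> c)" by auto
  then show ?thesis unfolding clear_congruence_def rel_of_inject by blast
qed

text \<open>The Skula topology separates points, since distinct primes \<open>p\<close> and \<open>q\<close> satisfy
  \<open>\<not> q \<le> p\<close> or \<open>\<not> p \<le> q\<close>; so \<open>{p}\<close> is closed.\<close>

lemma to_skula_Compl_singleton:
  "\<exists>A. to_skula A = {q. prime_element q} - {p}" if "prime_element p" for p :: "'a::frame"
proof
  let ?\<C> = "{C. p \<notin> to_skula C}"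
  have "q \<in> to_skula (\<Squnion>?\<C>)" if q: "prime_element q" "q \<noteq> p" for q
  proof (cases "q \<le> p")
    case True
    with q(2) have "\<not> p \<le> q" by auto
    then have "q \<in> to_skula (\<nabla> p)" "\<nabla> p \<in> ?\<C>"
      using q by (auto simp: to_skula(2) spectrum_open_def)
    then show ?thesis unfolding to_skula_Sup by blast
  next
    case False
    then have "q \<in> to_skula (\<Delta> q)" "\<Delta> q \<in> ?\<C>"
      using q by (auto simp: to_skula_delta)
    then show ?thesis unfolding to_skula_Sup by blast
  qed
  moreover have "p \<notin> to_skula (\<Squnion>?\<C>)" unfolding to_skula_Sup by blast
  ultimately show "to_skula (\<Squnion>?\<C>) = {q. prime_element q} - {p}"
    using to_skula_prime by blast
qed

text \<open>Clearness provides a \<open>Z\<close> with image \<open>{p}\<close>. Any pair \<open>x \<le> y\<close> of \<open>Z\<close> separated by \<open>p\<close> is then separated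
  by no other prime, which is the \<open>T\<^sub>D\<close> condition for the opens of \<open>y\<close> and \<open>x\<close>.\<close>

lemma TD_if_clear_skula_kernel:
  assumes cl: "clear_congruence (skula_kernel :: 'a::frame congruence congruence)"
  shows "TD_space (spectrum :: 'a topology)"
  unfolding TD_space_def topspace_spectrum
proof clarify
  fix p :: 'a
  assume pr: "prime_element p"
  obtain c where c: "skula_kernel = \<partial> (c :: 'a congruence)"
    using cl unfolding clear_congruence_def by blast
  have le_c: "C \<le> c \<longleftrightarrow> to_skula C = {}" for C
    using bot_clear_congruence_of_iff[of C c] rel_of_skula_kernel[of \<bottom> C]
    by (auto simp: c[symmetric] to_skula_bot)
  obtain A where A: "to_skula A = {q. prime_element q} - {p}"
    using to_skula_Compl_singleton[OF pr] by blast
  then have "to_skula A \<noteq> to_skula \<top>" using pr by (auto simp: to_skula_top)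
  then have "(A, \<top>) \<notin> rel_of (\<partial> c)" by (simp add: c[symmetric] rel_of_skula_kernel)
  then obtain Z where "\<not> (A \<sqinter> Z \<le> c \<longleftrightarrow> Z \<le> c)"
    by (auto simp: mem_clear_congruence_of_iff)
  then have "to_skula A \<inter> to_skula Z = {}" "to_skula Z \<noteq> {}"
    unfolding le_c to_skula_inf by blast+
  then have Z: "to_skula Z = {p}"
    using A to_skula_prime by blast
  then have "p \<in> to_skula Z" by simp
  then obtain x y where xy: "(x, y) \<in> rel_of Z" "x \<le> y" "x \<le> p" "\<not> y \<le> p"
    unfolding mem_to_skula_iff by blast
  have only: "q = p" if "prime_element q" "x \<le> q" "\<not> y \<le> q" for q
  proof -
    have "q \<in> to_skula Z" unfolding mem_to_skula_iff using that xy by blast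
    with Z show ?thesis by simp
  qed
  have "p \<in> spectrum_open y" using pr xy by (simp add: spectrum_open_def)
  moreover have "spectrum_open y - {p} = spectrum_open x"
    using only xy order_trans[OF xy(2)] by (auto simp: spectrum_open_def)
  ultimately show "\<exists>U. openin spectrum U \<and> p \<in> U \<and> openin spectrum (U - {p})"
    unfolding openin_spectrum by blast
qed

lemma largest_dense_eq_clear: "\<DD> = \<partial> \<bottom>"
proof -
  have "rel_of \<DD> = rel_of (\<partial> \<bottom>)"
    by (simp add: largest_dense_congruence.rep_eq clear_congruence_of.rep_eq bot_unique)
  then show ?thesis unfolding rel_of_inject .
qed

lemma eq_largest_dense_iff: "C = \<DD> \<longleftrightarrow> dense_congruence C \<and> clear_congruence C"
proof
  assume "C = \<DD>"
  then show "dense_congruence C \<and> clear_congruence C"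
    using largest_dense_congruence_is_greatest(1) largest_dense_eq_clear
    unfolding clear_congruence_def by blast
next
  assume "dense_congruence C \<and> clear_congruence C"
  then obtain c where c: "C = \<partial> c" and d: "dense_congruence (\<partial> c)"
    unfolding clear_congruence_def by blast
  have "(\<bottom>, c) \<in> rel_of (\<partial> c)" by (simp add: bot_clear_congruence_of_iff)
  then have "c = \<bottom>" using d unfolding dense_congruence_def by blast
  with c show "C = \<DD>" by (simp add: largest_dense_eq_clear)
qed

section \<open>Sober spaces and the spectrum\<close>

lemma closedin_spectrum:
  "closedin spectrum C \<longleftrightarrow> (\<exists>a. C = {p. prime_element p \<and> a \<le> p})"
proof -
  have 1: "{p. prime_element p} - spectrum_open a = {p. prime_element p \<and> a \<le> p}" for a :: 'a
    by (auto simp: spectrum_open_def)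
  show ?thesis
  proof
    assume "closedin spectrum C"
    then obtain a where "C \<subseteq> {p. prime_element p}" "{p. prime_element p} - C = spectrum_open a"
      unfolding closedin_def topspace_spectrum openin_spectrum by blast
    then have "C = {p. prime_element p} - spectrum_open a" by blast
    then show "\<exists>a. C = {p. prime_element p \<and> a \<le> p}" unfolding 1 by blast
  next
    assume "\<exists>a. C = {p. prime_element p \<and> a \<le> p}"
    then obtain a where "C = topspace spectrum - spectrum_open a"
      unfolding topspace_spectrum 1 by blast
    moreover have "openin spectrum (spectrum_open a)"
      unfolding openin_spectrum by blast
    ultimately show "closedin spectrum C" by (simp add: closedin_diff)
  qed
qed

lemma closure_of_singleton_spectrum:
  assumes "prime_element p"
  shows "spectrum closure_of {p} = {q. prime_element q \<and> p \<le> q}"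
proof (rule closure_of_unique)
  show "{p} \<subseteq> {q. prime_element q \<and> p \<le> q}" using assms by simp
  show "closedin spectrum {q. prime_element q \<and> p \<le> q}" unfolding closedin_spectrum by blast
  show "{q. prime_element q \<and> p \<le> q} \<subseteq> T" if "{p} \<subseteq> T" "closedin spectrum T" for T
    using that unfolding closedin_spectrum by (auto intro: order_trans)
qed

text \<open>The generic point of an irreducible closed set is its infimum.\<close>

lemma sober_spectrum: "sober_space (spectrum :: 'a::frame topology)"
  unfolding sober_space_def
proof (intro allI impI)
  fix C :: "'a set"
  assume irr: "irreducible_closed spectrum C"
  then have "closedin spectrum C" and ne: "C \<noteq> {}"
    unfolding irreducible_closed_def by simp_all
  then obtain a where a: "C = {p. prime_element p \<and> a \<le> p}"
    unfolding closedin_spectrum by auto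
  have pr: "prime_element (\<Sqinter>C)"
    unfolding prime_element_def
  proof (intro conjI allI impI)
    obtain q where "q \<in> C" using ne by blast
    then have "\<Sqinter>C \<le> q" by (rule Inf_lower)
    moreover have "prime_element q" using \<open>q \<in> C\<close> unfolding a by simp
    ultimately show "\<Sqinter>C \<noteq> \<top>" unfolding prime_element_def by (metis top_le)
  next
    fix u v
    assume uv: "u \<sqinter> v \<le> \<Sqinter>C"
    let ?D = "\<lambda>u. {p. prime_element p \<and> a \<squnion> u \<le> p}"
    have "u \<le> p \<or> v \<le> p" if "p \<in> C" for p
    proof -
      have "u \<sqinter> v \<le> p" using uv Inf_lower[OF that] by (rule order_trans)
      moreover have "prime_element p" using that by (simp add: a)
      ultimately show ?thesis unfolding prime_element_def by blast
    qed
    then have "C = ?D u \<union> ?D v" unfolding a by auto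
    moreover have "closedin spectrum (?D u)" for u unfolding closedin_spectrum by blast
    ultimately have "C = ?D u \<or> C = ?D v" using irr unfolding irreducible_closed_def by simp
    moreover have "w \<le> \<Sqinter>C" if "C = ?D w" for w
    proof (rule Inf_greatest)
      fix p
      assume "p \<in> C"
      then have "p \<in> ?D w" using that by (rule subst[rotated])
      then show "w \<le> p" by simp
    qed
    ultimately show "u \<le> \<Sqinter>C \<or> v \<le> \<Sqinter>C" by blast
  qed
  have "C = spectrum closure_of {\<Sqinter>C}"
    unfolding closure_of_singleton_spectrum[OF pr]
  proof
    show "C \<subseteq> {q. prime_element q \<and> \<Sqinter>C \<le> q}"
      using a Inf_lower[of _ C] by blast
    have "a \<le> \<Sqinter>C"
      by (rule Inf_greatest) (simp add: a)
    then have "q \<in> C" if "prime_element q" "\<Sqinter>C \<le> q" for q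
      using that order_trans[of a "\<Sqinter>C" q] by (simp add: a)
    then show "{q. prime_element q \<and> \<Sqinter>C \<le> q} \<subseteq> C" by blast
  qed
  moreover have "p = q"
    if "prime_element p" "prime_element q" "spectrum closure_of {p} = spectrum closure_of {q}"
    for p q :: 'a
  proof (rule antisym)
    have "{r. prime_element r \<and> p \<le> r} = {r. prime_element r \<and> q \<le> r}"
      using that by (simp add: closure_of_singleton_spectrum)
    then show "p \<le> q" "q \<le> p" using that(1,2) by blast+
  qed
  ultimately show "\<exists>!x. x \<in> topspace spectrum \<and> C = spectrum closure_of {x}"
    unfolding topspace_spectrum mem_Collect_eq using pr by metis
qed

lemma iso_to_opens_spectrum:
  assumes "spatial TYPE('a::frame)"
  shows "iso_to_opens TYPE('a) (spectrum :: 'a topology)"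
  unfolding iso_to_opens_def
proof (intro exI conjI)
  show "frame_hom_to_opens spectrum (spectrum_open :: 'a \<Rightarrow> 'a set)"
    unfolding frame_hom_to_opens_def openin_spectrum topspace_spectrum
    by (auto simp: spectrum_open_top spectrum_open_inf spectrum_open_Sup)
  show "bij_betw (spectrum_open :: 'a \<Rightarrow> 'a set) UNIV {U. openin spectrum U}"
    using assms unfolding bij_betw_def spatial_def openin_spectrum by auto
qed

lemma frame_iso_le_iff:
  assumes "frame_hom_to_opens X f" "inj f"
  shows "f a \<subseteq> f b \<longleftrightarrow> a \<le> b"
proof -
  have "f a \<subseteq> f b \<longleftrightarrow> f (a \<sqinter> b) = f a"
    using assms(1) by (auto simp: frame_hom_to_opens_def)
  also have "\<dots> \<longleftrightarrow> a \<le> b" using assms(2) by (metis inj_eq inf.absorb_iff1)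
  finally show ?thesis .
qed

lemma prime_of_point:
  assumes f: "frame_hom_to_opens X f" and x: "x \<in> topspace X"
  shows "\<exists>p. prime_element p \<and> (\<forall>c. x \<in> f c \<longleftrightarrow> \<not> c \<le> p)"
proof (intro exI conjI)
  let ?p = "\<Squnion>{c. x \<notin> f c}"
  have "x \<notin> f ?p" using f by (auto simp: frame_hom_to_opens_def)
  then have iff: "x \<in> f c \<longleftrightarrow> \<not> c \<le> ?p" for c
    using f unfolding frame_hom_to_opens_def
    by (metis (mono_tags, lifting) IntE Sup_upper inf.absorb1 mem_Collect_eq)
  then show "\<forall>c. x \<in> f c \<longleftrightarrow> \<not> c \<le> ?p" by blast
  have "x \<in> f \<top>" using f x by (simp add: frame_hom_to_opens_def)
  then have "?p \<noteq> \<top>" using iff[of \<top>] by (metis top_greatest)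
  moreover have "a \<le> ?p \<or> b \<le> ?p" if "a \<sqinter> b \<le> ?p" for a b
    using that f iff[of "a \<sqinter> b"] iff[of a] iff[of b] by (auto simp: frame_hom_to_opens_def)
  ultimately show "prime_element ?p" unfolding prime_element_def by blast
qed

lemma spatial_if_iso_to_opens:
  assumes "iso_to_opens TYPE('a::frame) X"
  shows "spatial TYPE('a)"
proof -
  obtain f :: "'a \<Rightarrow> _" where f: "frame_hom_to_opens X f" and inj: "inj f"
    using assms unfolding iso_to_opens_def bij_betw_def by blast
  have le: "a \<le> b" if "spectrum_open a = spectrum_open b" for a b :: 'a
    unfolding frame_iso_le_iff[OF f inj, symmetric]
  proof
    fix x
    assume x: "x \<in> f a"
    then have "x \<in> topspace X"
      using f by (meson frame_hom_to_opens_def openin_subset subsetD)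
    then obtain p where "prime_element p" "\<forall>c. x \<in> f c \<longleftrightarrow> \<not> c \<le> p"
      using prime_of_point[OF f] by blast
    then show "x \<in> f b" using x that by (auto simp: spectrum_open_def)
  qed
  show ?thesis unfolding spatial_def by (rule injI) (metis le antisym)
qed

text \<open>Primality of \<open>p\<close> is irreducibility of the complement of \<open>f p\<close>, so sobriety provides a generic
  point of it.\<close>

lemma point_of_prime:
  fixes f :: "'a::frame \<Rightarrow> 'b set"
  assumes sob: "sober_space X" and f: "frame_hom_to_opens X f"
    and bij: "bij_betw f UNIV {U. openin X U}" and p: "prime_element p"
  shows "\<exists>x \<in> topspace X. \<forall>c. x \<in> f c \<longleftrightarrow> \<not> c \<le> p"
proof -
  have inj: "inj f" and surj: "\<And>U. openin X U \<Longrightarrow> \<exists>a. U = f a"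
    using bij unfolding bij_betw_def by blast+
  have op: "openin X (f a)" for a
    using f unfolding frame_hom_to_opens_def by simp
  then have sub: "f a \<subseteq> topspace X" for a
    by (rule openin_subset)
  have "f p \<noteq> f \<top>" using p inj by (auto simp: prime_element_def inj_eq)
  then have ne: "topspace X - f p \<noteq> {}" using f sub[of p] by (auto simp: frame_hom_to_opens_def)
  have "topspace X - f p = D \<or> topspace X - f p = E"
    if D: "closedin X D" and E: "closedin X E" and DE: "topspace X - f p = D \<union> E" for D E
  proof -
    obtain a b where a: "topspace X - D = f a" and b: "topspace X - E = f b"
      using surj D E unfolding closedin_def by metis
    have "f (a \<sqinter> b) = f a \<inter> f b" using f by (simp add: frame_hom_to_opens_def)
    also have "\<dots> = f p" using DE a b sub[of p] by blast
    finally have "a \<sqinter> b = p" using inj by (simp add: inj_eq)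
    then have "a = p \<or> b = p"
      using p unfolding prime_element_def by (metis antisym inf_le1 inf_le2 order_refl)
    then show ?thesis
      using a b closedin_subset[OF D] closedin_subset[OF E] by blast
  qed
  then have "irreducible_closed X (topspace X - f p)"
    unfolding irreducible_closed_def using ne op by (auto intro: closedin_diff)
  then obtain x where x: "x \<in> topspace X" and cl: "topspace X - f p = X closure_of {x}"
    using sob unfolding sober_space_def by blast
  have "x \<in> f c \<longleftrightarrow> \<not> c \<le> p" for c
  proof -
    have "x \<notin> f c \<longleftrightarrow> {x} \<subseteq> topspace X - f c" using x by blast
    also have "\<dots> \<longleftrightarrow> X closure_of {x} \<subseteq> topspace X - f c"
      using op[of c] x closure_of_subset[of "{x}" X]
        closure_of_minimal[of "{x}" "topspace X - f c" X]
      by (auto intro: closedin_diff)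
    also have "\<dots> \<longleftrightarrow> f c \<subseteq> f p" unfolding cl[symmetric] using sub[of c] by blast
    finally show ?thesis unfolding frame_iso_le_iff[OF f inj] by blast
  qed
  with x show ?thesis by blast
qed

lemma TD_spectrum_if_iso_to_opens:
  fixes X :: "'b topology"
  assumes sob: "sober_space X" and T: "TD_space X" and iso: "iso_to_opens TYPE('a::frame) X"
  shows "TD_space (spectrum :: 'a topology)"
  unfolding TD_space_def topspace_spectrum
proof clarify
  fix p :: 'a
  assume p: "prime_element p"
  obtain f :: "'a \<Rightarrow> 'b set"
    where f: "frame_hom_to_opens X f" and bij: "bij_betw f UNIV {U. openin X U}"
    using iso unfolding iso_to_opens_def by blast
  have surj: "\<exists>a. U = f a" if "openin X U" for U
    using bij that unfolding bij_betw_def by blast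
  obtain x where xX: "x \<in> topspace X" and x: "\<And>c. x \<in> f c \<longleftrightarrow> \<not> c \<le> p"
    using point_of_prime[OF sob f bij p] by blast
  obtain U where "openin X U" "x \<in> U" "openin X (U - {x})"
    using T xX unfolding TD_space_def by blast
  then obtain a b where ab: "x \<in> f a" "f a - {x} = f b"
    using surj by metis
  have "q \<in> spectrum_open a - {p} \<longleftrightarrow> q \<in> spectrum_open b" if q: "prime_element q" for q
  proof -
    obtain y where y: "\<And>c. y \<in> f c \<longleftrightarrow> \<not> c \<le> q"
      using point_of_prime[OF sob f bij q] by blast
    have "y \<in> f b \<longleftrightarrow> y \<in> f a \<and> q \<noteq> p"
    proof
      assume "y \<in> f b"
      moreover have "x \<notin> f b" using ab(2) by blast
      ultimately show "y \<in> f a \<and> q \<noteq> p" using ab(2) x y by blast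
    next
      assume ya: "y \<in> f a \<and> q \<noteq> p"
      have "y \<noteq> x" using ya x y by (metis antisym order_refl)
      then show "y \<in> f b" using ya ab(2) by blast
    qed
    then show ?thesis using q y by (auto simp: spectrum_open_def)
  qed
  then have "spectrum_open a - {p} = spectrum_open b"
    by (auto simp: spectrum_open_def)
  moreover have "p \<in> spectrum_open a" using p ab(1) x by (simp add: spectrum_open_def)
  ultimately show "\<exists>U. openin spectrum U \<and> p \<in> U \<and> openin spectrum (U - {p})"
    unfolding openin_spectrum by blast
qed

section \<open>The equivalences\<close>

unbundle no lattice_syntax

theorem mainTheorem15:
  fixes S :: "'a::frame congruence congruence"
  assumes "S = skula_kernel"
  shows "(S \<le> \<DD> \<longleftrightarrow> spatial TYPE('a)) \<and>
    (clear_congruence S \<longleftrightarrow> TD_space (spectrum :: 'a topology)) \<and>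
    (S = \<DD> \<longleftrightarrow>
      (\<exists>X :: 'a topology. sober_space X \<and> TD_space X \<and> iso_to_opens TYPE('a) X)) \<and>
    (\<forall>X :: 'b topology.
      sober_space X \<and> TD_space X \<and> iso_to_opens TYPE('a) X \<longrightarrow> S = \<DD>)"
proof -
  have clear: "clear_congruence S \<longleftrightarrow> TD_space (spectrum :: 'a topology)"
    unfolding assms using clear_skula_kernel_if_TD TD_if_clear_skula_kernel by blast
  have dense: "dense_congruence S \<longleftrightarrow> spatial TYPE('a)"
    unfolding assms by (rule dense_skula_kernel_iff_spatial)
  have eq: "S = \<DD> \<longleftrightarrow> spatial TYPE('a) \<and> TD_space (spectrum :: 'a topology)"
    unfolding eq_largest_dense_iff clear dense ..
  have "S = \<DD>" if "sober_space X" "TD_space X" "iso_to_opens TYPE('a) X" for X :: "'c topology"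
    unfolding eq using that spatial_if_iso_to_opens TD_spectrum_if_iso_to_opens by blast
  note a = this[where 'c1 = 'a] and b = this[where 'c1 = 'b]
  show ?thesis
    using clear dense a b eq sober_spectrum iso_to_opens_spectrum le_largest_dense_iff by metis
qed

end
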